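(* Let $N$ be an odd positive integer, let $\mathbf{b}_o$ be the vector of odd real spherical harmonics of degree at most $N$ (in any one of the three geometries described in the context), let $N_o$ be its length, let $\mathbf{n}$ be an admissible unit normal vector for that geometry, and let $r(\boldsymbol{\Omega})=\boldsymbol{\Omega}-2(\mathbf{n}\cdot\boldsymbol{\Omega})\mathbf{n}$. Then for every real number $\rho\in(-1,1)$ (independent of $\boldsymbol{\Omega}$), the $N_o\times N_o$ matrix $$H_o(\mathbf{n})=\int_{\{\boldsymbol{\Omega}\in\mathcal{S}^2:\ \mathbf{n}\cdot\boldsymbol{\Omega}<0\}}\mathbf{b}_o(\boldsymbol{\Omega})\left(\mathbf{b}_o(\boldsymbol{\Omega})^T-\rho\,\mathbf{b}_o(r(\boldsymbol{\Omega}))^T\right)\mathrm{d}\boldsymbol{\Omega}$$ is invertible.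
   Context: $\mathcal{S}^2$ is the unit sphere in $\mathbb{R}^3$ with surface measure $\mathrm{d}\boldsymbol{\Omega}$, parametrized by $\boldsymbol{\Omega}=(\sqrt{1-\mu^2}\cos\varphi,\sqrt{1-\mu^2}\sin\varphi,\mu)^T$, $\mu\in[-1,1]$, $\varphi\in[0,2\pi]$, $\mathrm{d}\boldsymbol{\Omega}=\mathrm{d}\varphi\,\mathrm{d}\mu$. Real spherical harmonics: for $l\ge 0$, $-l\le m\le l$, $$S_l^m(\mu,\varphi)=\begin{cases}\Theta_{lm}(\mu)\sqrt2\cos(m\varphi), & m>0,\\ \Theta_{l0}(\mu), & m=0,\\ \Theta_{l|m|}(\mu)\sqrt2\sin(|m|\varphi), & m<0,\end{cases}$$ where $\Theta_{lm}(\mu)=\sqrt{\frac{2l+1}{4\pi}\frac{(l-m)!}{(l+m)!}}\,P_l^m(\mu)$ and $P_l^m(\mu)=\frac{1}{2^l l!}(1-\mu^2)^{m/2}\frac{\mathrm{d}^{l+m}}{\mathrm{d}\mu^{l+m}}(\mu^2-1)^l$. They form an orthonormal basis of $L_2(\mathcal{S}^2,\mathbb{R})$ and satisfy $S_l^m(-\boldsymbol{\Omega})=(-1)^lS_l^m(\boldsymbol{\Omega})$; $S_l^m$ is called odd if $l$ is odd. The (angular) basis of order $N$ and the admissible normals are, depending on the geometry: (3D) all $S_l^m$ with $0\le l\le N$, $-l\le m\le l$, and $\mathbf{n}\in\mathcal{S}^2$ arbitrary; (2D) all $S_l^m$ with $0\le l\le N$, $|m|\le l$ and $l+|m|$ even,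 and $\mathbf{n}\in\mathcal{S}^2$ with $n_z=0$; (1D, slab geometry) $S_0^0,S_1^0,\dots,S_N^0$, and $\mathbf{n}=(0,0,\pm1)^T$. $\mathbf{b}_o$ is the column vector, of length $N_o$, of those functions in the basis with $l$ odd. Integrals of vectors and matrices are taken entrywise. *)

theory Defs
  imports "HOL-Analysis.Analysis" "Jordan_Normal_Form.Matrix"
begin

text \<open>Points and normals are of type \<^typ>\<open>real^3\<close>; the basis vector and the matrix, whose size
  depends on the order, use the vectors and matrices of \<^theory>\<open>Jordan_Normal_Form.Matrix\<close>.
  For the symbols used by both libraries, only the meaning from \<^theory>\<open>HOL-Analysis.Analysis\<close> is kept.\<close>

no_notation vec_index (infixl "$" 100)
no_notation scalar_prod (infix "\<bullet>" 70)

definition sphere_point :: "real \<times> real \<Rightarrow> real^3" where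
  "sphere_point = (\<lambda>(\<mu>, \<phi>). vector [sqrt (1 - \<mu>\<^sup>2) * cos \<phi>, sqrt (1 - \<mu>\<^sup>2) * sin \<phi>, \<mu>])"

definition surface_measure :: "(real^3) measure" where
  "surface_measure = distr (restrict_space lborel ({-1..1} \<times> {0..2 * pi})) borel sphere_point"

text \<open>The power \<open>(1 - \<mu>\<^sup>2)\<^bsup>m/2\<^esup>\<close> is written with \<^const>\<open>sqrt\<close> because \<open>0 powr 0 = 0\<close>, which would be
  wrong at the poles for \<open>m = 0\<close>.\<close>

definition assoc_legendre :: "nat \<Rightarrow> nat \<Rightarrow> real \<Rightarrow> real" where
  "assoc_legendre l m \<mu> =
     1 / (2 ^ l * fact l) * sqrt (1 - \<mu>\<^sup>2) ^ m * (deriv ^^ (l + m)) (\<lambda>x. (x\<^sup>2 - 1) ^ l) \<mu>"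

definition Theta :: "nat \<Rightarrow> nat \<Rightarrow> real \<Rightarrow> real" where
  "Theta l m \<mu> =
     sqrt ((2 * real l + 1) / (4 * pi) * (fact (l - m) / fact (l + m))) * assoc_legendre l m \<mu>"

definition real_sph_harm :: "nat \<Rightarrow> int \<Rightarrow> real \<Rightarrow> real \<Rightarrow> real" where
  "real_sph_harm l m \<mu> \<phi> =
     (if m > 0 then Theta l (nat m) \<mu> * (sqrt 2 * cos (of_int m * \<phi>))
      else if m = 0 then Theta l 0 \<mu>
      else Theta l (nat \<bar>m\<bar>) \<mu> * (sqrt 2 * sin (of_int \<bar>m\<bar> * \<phi>)))"

text \<open>The azimuth is taken in \<open>[0, 2\<pi>)\<close>. Its value at the poles is irrelevant, since
  \<open>Theta l m (\<plusminus>1) = 0\<close> for \<open>m > 0\<close>; \<open>sph_harm_sphere_point\<close> below confirms that the function on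
  the sphere is the one given by the parametrization.\<close>

definition sph_harm :: "nat \<Rightarrow> int \<Rightarrow> real^3 \<Rightarrow> real" where
  "sph_harm l m \<Omega> = real_sph_harm l m (\<Omega> $ 3) (Arg2pi (Complex (\<Omega> $ 1) (\<Omega> $ 2)))"

lemma sph_harm_sphere_point:
  assumes "\<mu> \<in> {-1..1}"
  shows "sph_harm l m (sphere_point (\<mu>, \<phi>)) = real_sph_harm l m \<mu> \<phi>"
proof (cases "\<mu>\<^sup>2 = 1")
  case True
  then show ?thesis
    by (auto simp: sph_harm_def sphere_point_def real_sph_harm_def Theta_def assoc_legendre_def)
next
  case False
  define s where "s = sqrt (1 - \<mu>\<^sup>2)"
  have "\<mu>\<^sup>2 \<le> 1" using assms by (simp add: abs_square_le_1 abs_le_iff)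
  with False have s: "s > 0" by (simp add: s_def)
  define \<psi> where "\<psi> = Arg2pi (Complex (s * cos \<phi>) (s * sin \<phi>))"
  have z: "Complex (s * cos \<phi>) (s * sin \<phi>) = of_real s * cis \<phi>"
    by (simp add: complex_eq_iff)
  have "cmod (of_real s * cis \<phi>) = s" using s by (simp add: norm_mult)
  then have "of_real s * cis \<phi> = of_real s * cis \<psi>"
    using Arg2pi_eq[of "of_real s * cis \<phi>"] by (simp add: \<psi>_def z cis_conv_exp)
  then have c: "cis \<psi> = cis \<phi>" using s by simp
  have "cis (real k * \<psi>) = cis (real k * \<phi>)" for k
    using arg_cong[OF c, of "\<lambda>z. z ^ k"] by (simp add: Complex.DeMoivre)
  then have k: "cos (real k * \<psi>) = cos (real k * \<phi>)" "sin (real k * \<psi>) = sin (real k * \<phi>)" for k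
    by (metis cis.sel(1), metis cis.sel(2))
  have "real_sph_harm l m \<mu> \<psi> = real_sph_harm l m \<mu> \<phi>"
    using k[of "nat \<bar>m\<bar>"] by (auto simp: real_sph_harm_def)
  then show ?thesis
    by (simp add: sph_harm_def sphere_point_def \<psi>_def s_def)
qed

datatype geometry = Slab_1D | Planar_2D | Full_3D

fun in_geometry :: "geometry \<Rightarrow> nat \<Rightarrow> int \<Rightarrow> bool" where
  "in_geometry Slab_1D l m \<longleftrightarrow> m = 0"
| "in_geometry Planar_2D l m \<longleftrightarrow> even (int l + \<bar>m\<bar>)"
| "in_geometry Full_3D l m \<longleftrightarrow> True"

fun admissible_normal :: "geometry \<Rightarrow> real^3 \<Rightarrow> bool" where
  "admissible_normal Slab_1D n \<longleftrightarrow> n = vector [0, 0, 1] \<or> n = vector [0, 0, -1]"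
| "admissible_normal Planar_2D n \<longleftrightarrow> n \<in> sphere 0 1 \<and> n $ 3 = 0"
| "admissible_normal Full_3D n \<longleftrightarrow> n \<in> sphere 0 1"

definition basis_indices :: "geometry \<Rightarrow> nat \<Rightarrow> (nat \<times> int) list" where
  "basis_indices g N = [(l, m). l \<leftarrow> [0..<Suc N], m \<leftarrow> [- int l..int l], in_geometry g l m]"

definition odd_basis_indices :: "geometry \<Rightarrow> nat \<Rightarrow> (nat \<times> int) list" where
  "odd_basis_indices g N = filter (\<lambda>(l, m). odd l) (basis_indices g N)"

definition odd_basis :: "geometry \<Rightarrow> nat \<Rightarrow> real^3 \<Rightarrow> real vec" where
  "odd_basis g N \<Omega> = vec_of_list (map (\<lambda>(l, m). sph_harm l m \<Omega>) (odd_basis_indices g N))"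

definition num_odd :: "geometry \<Rightarrow> nat \<Rightarrow> nat" where
  "num_odd g N = length (odd_basis_indices g N)"

definition reflect :: "real^3 \<Rightarrow> real^3 \<Rightarrow> real^3" where
  "reflect n \<Omega> = \<Omega> - (2 * (n \<bullet> \<Omega>)) *\<^sub>R n"

definition H_odd :: "geometry \<Rightarrow> nat \<Rightarrow> real \<Rightarrow> real^3 \<Rightarrow> real mat" where
  "H_odd g N \<rho> n = mat (num_odd g N) (num_odd g N) (\<lambda>(i, j).
     LINT \<Omega>:{\<Omega> \<in> sphere 0 1. n \<bullet> \<Omega> < 0}|surface_measure.
       vec_index (odd_basis g N \<Omega>) i *
       (vec_index (odd_basis g N \<Omega>) j - \<rho> * vec_index (odd_basis g N (reflect n \<Omega>)) j))"

end

theory Submission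
  imports Defs "Jordan_Normal_Form.Determinant"
begin

no_notation vec_index (infixl "$" 100)
no_notation scalar_prod (infix "\<bullet>" 70)

text \<open>The quadratic form of the matrix is positive away from \<open>0\<close>, so its kernel is trivial. For a coefficient vector \<open>v\<close> let \<open>f\<close> be the odd function on the
  sphere with these coefficients. The quadratic form at \<open>v\<close> is the integral of \<open>f (f - \<rho> (f \<circ> reflect n))\<close> over the
  hemisphere, and the integral of \<open>\<bar>f (f \<circ> reflect n)\<bar>\<close> is at most that of \<open>f\<^sup>2\<close>: minus the reflection is a rotation
  preserving the hemisphere, and it agrees with the reflection up to the sign that oddness provides. As \<open>\<bar>\<rho>\<bar> < 1\<close>,
  a vector in the kernel gives an \<open>f\<close> with \<open>f\<^sup>2\<close> of integral \<open>0\<close> over the hemisphere, hence, again by oddness, over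
  the sphere (\<open>hemisphere_form_definite\<close>). A continuous \<open>f\<close> of this kind is zero, and then so are its coefficients.

  Two facts carry this argument. The first is the invariance of the surface measure under all orthogonal maps
  (\<open>surface_measure_orthogonal\<close>), which is not visible in its definition by longitude and height. It is inherited
  from Lebesgue measure, since the surface measure of a set is three times the volume of the cone over it
  (\<open>surface_measure_eq_cone\<close>). The second is the linear independence of the spherical harmonics as functions on the
  sphere (\<open>poly_harm_independent\<close>); it follows from the degrees of the Legendre factors and the independence of the
  trigonometric functions. The three geometries differ only in the choice of a subfamily of the
  spherical harmonics and of a set of unit vectors, so one proof serves them all.\<close>

section \<open>Coordinates in three-dimensional space\<close>

lemma measurable_vec3 [measurable]:
  assumes [measurable]: "f \<in> borel_measurable M" "g \<in> borel_measurable M" "h \<in> borel_measurable M"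
  shows "(\<lambda>x. vector [f x, g x, h x] :: real^3) \<in> borel_measurable M"
proof -
  have "(\<lambda>x. vector [f x, g x, h x] :: real^3)
      = (\<lambda>x. f x *\<^sub>R axis 1 1 + g x *\<^sub>R axis 2 1 + h x *\<^sub>R axis 3 1)"
    by (auto simp: fun_eq_iff Finite_Cartesian_Product.vec_eq_iff forall_3 axis_def)
  then show ?thesis by simp
qed

lemma Basis_vec3: "(Basis :: (real^3) set) = {axis 1 1, axis 2 1, axis 3 1}"
proof -
  have "(Basis :: (real^3) set) = (\<lambda>i. axis i 1) ` UNIV" by (auto simp: Basis_vec_def)
  also have "(UNIV :: 3 set) = {1, 2, 3}" using exhaust_3 by auto
  finally show ?thesis by simp
qed

lemma emeasure_lborel_Times:
  fixes A :: "'a::euclidean_space set" and B :: "'b::euclidean_space set"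
  assumes "A \<in> sets borel" "B \<in> sets borel"
  shows "emeasure lborel (A \<times> B) = emeasure lborel A * emeasure lborel B"
  using assms by (simp add: lborel_prod[symmetric] lborel.emeasure_pair_measure_Times)

lemma box_vec3:
  fixes l u :: "real^3"
  shows "x \<in> box l u \<longleftrightarrow> l$1 < x$1 \<and> x$1 < u$1 \<and> l$2 < x$2 \<and> x$2 < u$2 \<and> l$3 < x$3 \<and> x$3 < u$3"
  by (auto simp: mem_box_cart forall_3)

text \<open>Volume in \<^typ>\<open>real^3\<close> is defined through an abstract orthonormal basis. Identifying it with the measure
  of nested pairs reduces volumes of product sets in \<^typ>\<open>real^3\<close> to lower dimensions.\<close>
lemma lborel_vec3:
  "distr lborel borel (\<lambda>(a, b, c). vector [a, b, c]) = (lborel :: (real^3) measure)" (is "?D = _")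
proof (rule lborel_eqI[symmetric])
  fix l u :: "real^3" assume le: "\<And>b. b \<in> Basis \<Longrightarrow> l \<bullet> b \<le> u \<bullet> b"
  have le': "l$1 \<le> u$1" "l$2 \<le> u$2" "l$3 \<le> u$3"
    using le[of "axis 1 1"] le[of "axis 2 1"] le[of "axis 3 1"] by (simp_all add: Basis_vec3 inner_axis)
  have "emeasure ?D (box l u) = emeasure lborel
      ((\<lambda>(a, b, c). vector [a, b, c]) -` box l u \<inter> space (lborel :: (real \<times> real \<times> real) measure))"
    by (subst emeasure_distr) (simp_all add: case_prod_beta borel_prod[symmetric])
  also have "((\<lambda>(a, b, c). vector [a, b, c]) -` box l u \<inter> space (lborel :: (real \<times> real \<times> real) measure))
      = box (l$1, l$2, l$3) (u$1, u$2, u$3)"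
    by (auto simp: box_vec3 mem_box Basis_prod_def)
  also have "emeasure lborel \<dots> = ennreal ((u$1 - l$1) * ((u$2 - l$2) * (u$3 - l$3)))"
  proof -
    have "box (l$1, l$2, l$3) (u$1, u$2, u$3) = box (l$1) (u$1) \<times> box (l$2) (u$2) \<times> box (l$3) (u$3)"
      by (auto simp: mem_box Basis_prod_def)
    then show ?thesis using le'
      by (simp add: emeasure_lborel_Times open_Times ennreal_mult)
  qed
  also have "((u$1 - l$1) * ((u$2 - l$2) * (u$3 - l$3))) = (\<Prod>b\<in>Basis. (u - l) \<bullet> b)"
    by (simp add: Basis_vec3 axis_eq_axis inner_axis)
  finally show "emeasure ?D (box l u) = ennreal (\<Prod>b\<in>Basis. (u - l) \<bullet> b)" .
qed simp

lemma measurable_sphere_point [measurable]: "sphere_point \<in> borel_measurable borel"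
proof -
  have "sphere_point = (\<lambda>p. vector [sqrt (1 - (fst p)\<^sup>2) * cos (snd p), sqrt (1 - (fst p)\<^sup>2) * sin (snd p), fst p])"
    by (simp add: sphere_point_def case_prod_beta fun_eq_iff)
  moreover have "\<dots> \<in> borel_measurable borel"
    unfolding borel_prod[symmetric] by measurable
  ultimately show ?thesis by simp
qed

lemma norm_vec3: "norm (x :: real^3) = sqrt ((x$1)\<^sup>2 + (x$2)\<^sup>2 + (x$3)\<^sup>2)"
  by (simp add: norm_vec_def L2_set_def sum_3)

lemma norm_sphere_point:
  assumes "\<mu> \<in> {-1..1}"
  shows "norm (sphere_point (\<mu>, \<phi>)) = 1"
proof -
  have "\<mu>\<^sup>2 \<le> 1" using assms by (simp add: abs_square_le_1 abs_le_iff)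
  then have "(sqrt (1 - \<mu>\<^sup>2) * cos \<phi>)\<^sup>2 + (sqrt (1 - \<mu>\<^sup>2) * sin \<phi>)\<^sup>2 = 1 - \<mu>\<^sup>2"
    by (simp add: power_mult_distrib distrib_left[symmetric])
  then show ?thesis by (simp add: norm_vec3 sphere_point_def)
qed

lemma sphere_point_cases:
  fixes x :: "real^3"
  assumes "norm x = 1"
  obtains \<mu> \<phi> where "\<mu> \<in> {-1..1}" "0 \<le> \<phi>" "\<phi> < 2 * pi" "x = sphere_point (\<mu>, \<phi>)"
proof
  let ?z = "Complex (x$1) (x$2)"
  have e: "(x$1)\<^sup>2 + (x$2)\<^sup>2 + (x$3)\<^sup>2 = 1" using assms by (simp add: norm_vec3)
  then have "(x$3)\<^sup>2 \<le> 1" using zero_le_power2[of "x$1"] zero_le_power2[of "x$2"] by linarith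
  then show "x$3 \<in> {-1..1}" by (simp add: abs_square_le_1 abs_le_iff)
  have "cmod ?z = sqrt (1 - (x$3)\<^sup>2)" using e by (simp add: cmod_def algebra_simps)
  then show "x = sphere_point (x$3, Arg2pi ?z)"
    using cos_Arg2pi[of ?z] sin_Arg2pi[of ?z] by (simp add: sphere_point_def Finite_Cartesian_Product.vec_eq_iff forall_3)
qed (use Arg2pi in auto)

section \<open>Spherical coordinates\<close>

text \<open>The radius is the cube root of the first coordinate rather than the coordinate itself. The Jacobian
  determinant \<open>r\<^sup>2\<close> of the usual coordinates then turns into the constant \<open>1/3\<close> (up to sign), so the
  map just divides volumes by 3 and no weighted integral appears.\<close>
definition spherical_coords :: "real^3 \<Rightarrow> real^3" where
  "spherical_coords v = root 3 (v$1) *\<^sub>R sphere_point (v$2, v$3)"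

lemma has_derivative_vec3:
  fixes f :: "'a::real_normed_vector \<Rightarrow> real^3"
  assumes "\<And>i. ((\<lambda>x. f x $ i) has_derivative (\<lambda>h. f' h $ i)) F"
  shows "(f has_derivative f') F"
proof -
  have "f = (\<lambda>x. \<Sum>i\<in>UNIV. f x $ i *\<^sub>R axis i 1)" "f' = (\<lambda>x. \<Sum>i\<in>UNIV. f' x $ i *\<^sub>R axis i 1)"
    by (auto simp: fun_eq_iff Finite_Cartesian_Product.vec_eq_iff forall_3 axis_def sum_3)
  moreover have "((\<lambda>x. \<Sum>i\<in>UNIV. f x $ i *\<^sub>R axis i 1 :: real^3) has_derivative
      (\<lambda>x. \<Sum>i\<in>UNIV. f' x $ i *\<^sub>R axis i 1)) F"
    by (intro has_derivative_sum has_derivative_scaleR_left assms)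
  ultimately show ?thesis by simp
qed

text \<open>Writing \<open>r\<close> for the radius, \<open>dr = dv / (3r\<^sup>2)\<close> contributes the factor \<open>1 / (3r\<^sup>2)\<close>, and the two tangential columns
  have length product \<open>r\<^sup>2\<close>: the parametrization of the unit sphere by height and azimuth is area preserving
  (Archimedes).\<close>
lemma spherical_coords_derivative:
  assumes "0 < v$1" "-1 < v$2" "v$2 < 1"
  obtains D where "(spherical_coords has_derivative D) (at v within S)" "\<bar>Determinants.det (matrix D)\<bar> = 1/3"
proof -
  define r s c d where "r = root 3 (v$1)" and "s = sqrt (1 - (v$2)\<^sup>2)"
    and "c = cos (v$3)" and "d = sin (v$3)"
  have s2: "s\<^sup>2 = 1 - (v$2)\<^sup>2" and s: "s > 0"
  proof -
    have "(v$2)\<^sup>2 < 1" using assms by (simp add: abs_square_less_1 abs_less_iff)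
    then show "s\<^sup>2 = 1 - (v$2)\<^sup>2" "s > 0" by (simp_all add: s_def)
  qed
  have r: "r > 0" using assms by (simp add: r_def)
  have cd: "c\<^sup>2 + d\<^sup>2 = 1" by (simp add: c_def d_def)
  define u where "u = v$2 / s"
  define q where "q = 1 / (3 * r\<^sup>2)"
  define J :: "real^3^3" where "J = vector
     [vector [q * s * c, - (r * u * c), - (r * s * d)],
      vector [q * s * d, - (r * u * d), r * s * c],
      vector [q * v$2, r, 0]]"
  have root: "((\<lambda>x::real^3. root 3 (x$1)) has_derivative (\<lambda>h. q * h$1)) (at v within S)"
  proof -
    have "(root 3 has_real_derivative inverse (3 * r\<^sup>2)) (at (v$1))"
      using DERIV_real_root[of 3 "v$1"] assms by (simp add: r_def numeral_2_eq_2)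
    then have "(root 3 has_derivative (\<lambda>y. y * inverse (3 * r\<^sup>2))) (at (v$1))"
      unfolding has_field_derivative_def by (rule has_derivative_eq_rhs) (auto simp: fun_eq_iff)
    moreover have "((\<lambda>x::real^3. x$1) has_derivative (\<lambda>h. h$1)) (at v within S)"
      by (intro bounded_linear_imp_has_derivative bounded_linear_vec_nth)
    ultimately have "((\<lambda>x::real^3. root 3 (x$1)) has_derivative (\<lambda>h. h$1 * inverse (3 * r\<^sup>2))) (at v within S)"
      by (rule has_derivative_compose[rotated])
    moreover have "inverse (3 * r\<^sup>2) = q" unfolding q_def by (rule inverse_eq_divide)
    ultimately show ?thesis by (simp only: mult.commute)
  qed
  have sq: "((\<lambda>x::real^3. sqrt (1 - (x$2)\<^sup>2)) has_derivative (\<lambda>h. - u * h$2)) (at v within S)"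
    using s by (auto intro!: derivative_eq_intros bounded_linear_imp_has_derivative bounded_linear_vec_nth
       simp: u_def s_def field_simps)
  have cs: "((\<lambda>x::real^3. cos (x$3)) has_derivative (\<lambda>h. - d * h$3)) (at v within S)"
     "((\<lambda>x::real^3. sin (x$3)) has_derivative (\<lambda>h. c * h$3)) (at v within S)"
    by (auto intro!: derivative_eq_intros bounded_linear_imp_has_derivative bounded_linear_vec_nth
       simp: c_def d_def field_simps)
  have "(spherical_coords has_derivative (\<lambda>h. J *v h)) (at v within S)"
  proof (rule has_derivative_vec3)
    fix i :: 3
    consider "i = 1" | "i = 2" | "i = 3" using exhaust_3 by blast
    then show "((\<lambda>x. spherical_coords x $ i) has_derivative (\<lambda>h. (J *v h) $ i)) (at v within S)"
    proof cases
      case 1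
      have "(\<lambda>x. spherical_coords x $ i) = (\<lambda>x. root 3 (x$1) * (sqrt (1 - (x$2)\<^sup>2) * cos (x$3)))"
        by (simp add: 1 spherical_coords_def sphere_point_def)
      moreover have "(\<lambda>h. (J *v h) $ i) =
          (\<lambda>h. r * (s * (- d * h$3) + - u * h$2 * c) + q * h$1 * (s * c))"
        by (simp add: 1 J_def matrix_vector_mult_def sum_3 algebra_simps)
      ultimately show ?thesis
        using has_derivative_mult[OF root has_derivative_mult[OF sq cs(1)]]
        by (simp only: r_def s_def c_def d_def)
    next
      case 2
      have "(\<lambda>x. spherical_coords x $ i) = (\<lambda>x. root 3 (x$1) * (sqrt (1 - (x$2)\<^sup>2) * sin (x$3)))"
        by (simp add: 2 spherical_coords_def sphere_point_def)
      moreover have "(\<lambda>h. (J *v h) $ i) =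
          (\<lambda>h. r * (s * (c * h$3) + - u * h$2 * d) + q * h$1 * (s * d))"
        by (simp add: 2 J_def matrix_vector_mult_def sum_3 algebra_simps)
      ultimately show ?thesis
        using has_derivative_mult[OF root has_derivative_mult[OF sq cs(2)]]
        by (simp only: r_def s_def c_def d_def)
    next
      case 3
      have "(\<lambda>x. spherical_coords x $ i) = (\<lambda>x. root 3 (x$1) * x$2)"
        by (simp add: 3 spherical_coords_def sphere_point_def)
      moreover have "(\<lambda>h. (J *v h) $ i) = (\<lambda>h. r * h$2 + q * h$1 * v$2)"
        by (simp add: 3 J_def matrix_vector_mult_def sum_3 algebra_simps)
      moreover have "((\<lambda>x. x$2) has_derivative (\<lambda>h. h$2)) (at v within S)"
        by (intro bounded_linear_imp_has_derivative bounded_linear_vec_nth)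
      ultimately show ?thesis
        using has_derivative_mult[OF root] by (simp only: r_def)
    qed
  qed
  moreover have "Determinants.det J = - 1/3"
  proof -
    have "Determinants.det J = - (q * r\<^sup>2) * ((c\<^sup>2 + d\<^sup>2) * (s\<^sup>2 + s * u * v$2))"
      by (simp add: det_3 J_def algebra_simps power2_eq_square)
    also have "s * u = v$2" using s by (simp add: u_def)
    finally show ?thesis using r by (simp add: cd s2 q_def power2_eq_square[of "v$2", symmetric])
  qed
  ultimately show ?thesis by (intro that[of "\<lambda>h. J *v h"]) auto
qed

definition spherical_domain :: "(real^3) set" where
  "spherical_domain = {v. v$1 \<in> {0<..<1} \<and> v$2 \<in> {-1<..<1} \<and> v$3 \<in> {0<..<2*pi}}"

lemma norm_spherical_coords:
  assumes "v \<in> spherical_domain"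
  shows "norm (spherical_coords v) = root 3 (v$1)"
  using assms norm_sphere_point[of "v$2" "v$3"] by (simp add: spherical_coords_def spherical_domain_def)

lemma sgn_spherical_coords:
  assumes "v \<in> spherical_domain"
  shows "sgn (spherical_coords v) = sphere_point (v$2, v$3)"
  using assms norm_sphere_point[of "v$2" "v$3"]
  by (simp add: spherical_coords_def spherical_domain_def sgn_scaleR) (simp add: sgn_div_norm)

lemma inj_on_spherical_coords: "inj_on spherical_coords spherical_domain"
proof (rule inj_onI)
  fix v w assume v: "v \<in> spherical_domain" and w: "w \<in> spherical_domain"
    and eq: "spherical_coords v = spherical_coords w"
  have 1: "v$1 = w$1" using norm_spherical_coords[OF v] norm_spherical_coords[OF w] eq by simp
  have sp: "sphere_point (v$2, v$3) = sphere_point (w$2, w$3)"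
    using sgn_spherical_coords[OF v] sgn_spherical_coords[OF w] eq by simp
  then have 2: "v$2 = w$2" by (simp add: sphere_point_def Finite_Cartesian_Product.vec_eq_iff forall_3)
  have "(v$2)\<^sup>2 < 1" using v by (simp add: abs_square_less_1 abs_less_iff spherical_domain_def)
  then have "sqrt (1 - (v$2)\<^sup>2) > 0" by simp
  then have "cos (v$3) = cos (w$3)" "sin (v$3) = sin (w$3)"
    using sp 2 by (auto simp: sphere_point_def Finite_Cartesian_Product.vec_eq_iff forall_3)
  then have "cis (v$3) = cis (w$3)" by (simp add: complex_eq_iff)
  then have "exp (\<i> * of_real (v$3)) = exp (\<i> * of_real (w$3))" by (simp add: cis_conv_exp)
  then have "Arg2pi (exp (\<i> * of_real (v$3))) = Arg2pi (exp (\<i> * of_real (w$3)))" by simp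
  moreover have "Arg2pi (exp (\<i> * of_real t)) = t" if "t \<in> {0<..<2*pi}" for t
    using that by (intro Arg2pi_unique[of 1]) auto
  ultimately have "v$3 = w$3" using v w by (simp add: spherical_domain_def)
  with 1 2 show "v = w" by (simp add: Finite_Cartesian_Product.vec_eq_iff forall_3)
qed

text \<open>The slit is where the azimuth would be \<open>0\<close> or the parameters degenerate: the meridian half-plane
  of azimuth \<open>0\<close>, including the z-axis. It is contained in a plane, hence a null set.\<close>
lemma spherical_coords_image:
  "spherical_coords ` spherical_domain = {x. 0 < norm x \<and> norm x < 1 \<and> \<not> (x$2 = 0 \<and> 0 \<le> x$1)}"
proof (intro equalityI subsetI)
  fix x assume "x \<in> spherical_coords ` spherical_domain"
  then obtain v where v: "v \<in> spherical_domain" and x: "x = spherical_coords v" by auto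
  have "(v$2)\<^sup>2 < 1" using v by (simp add: abs_square_less_1 abs_less_iff spherical_domain_def)
  then have s: "sqrt (1 - (v$2)\<^sup>2) > 0" by simp
  have "\<not> (sin (v$3) = 0 \<and> 0 \<le> cos (v$3))"
  proof (rule notI)
    assume A: "sin (v$3) = 0 \<and> 0 \<le> cos (v$3)"
    then have "cos (v$3) = 1" using sin_cos_squared_add[of "v$3"] by (simp add: power2_eq_1_iff)
    then obtain k :: int where "v$3 = of_int k * (2 * pi)"
      by (auto simp: cos_one_2pi_int mult.assoc)
    with v have "0 < k \<and> k < 1"
      by (auto simp: spherical_domain_def zero_less_mult_iff)
    then have "0 < k" "k < 1" by blast+
    then show False by linarith
  qed
  moreover have "root 3 (v$1) > 0" "root 3 (v$1) < 1" using v by (auto simp: spherical_domain_def)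
  moreover from this have "spherical_coords v \<noteq> 0" using norm_spherical_coords[OF v] by auto
  ultimately show "x \<in> {x. 0 < norm x \<and> norm x < 1 \<and> \<not> (x$2 = 0 \<and> 0 \<le> x$1)}"
    using s by (simp add: x norm_spherical_coords[OF v])
      (auto simp: spherical_coords_def sphere_point_def zero_le_mult_iff)
next
  fix x :: "real^3" assume x: "x \<in> {x. 0 < norm x \<and> norm x < 1 \<and> \<not> (x$2 = 0 \<and> 0 \<le> x$1)}"
  then have "norm (sgn x) = 1" by (simp add: norm_sgn)
  then obtain \<mu> \<phi> where mp: "\<mu> \<in> {-1..1}" "0 \<le> \<phi>" "\<phi> < 2 * pi" "sgn x = sphere_point (\<mu>, \<phi>)"
    by (rule sphere_point_cases)
  have eq: "x = norm x *\<^sub>R sphere_point (\<mu>, \<phi>)" using x by (simp add: mp(4)[symmetric] sgn_div_norm)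
  define v :: "real^3" where "v = vector [norm x ^ 3, \<mu>, \<phi>]"
  have xv: "x = spherical_coords v"
    by (simp add: spherical_coords_def v_def real_root_power_cancel eq[symmetric])
  have c: "\<not> (x$2 = 0 \<and> 0 \<le> x$1)" "0 < norm x" using x by auto
  have x1: "x$1 = norm x * (sqrt (1 - \<mu>\<^sup>2) * cos \<phi>)" and x2: "x$2 = norm x * (sqrt (1 - \<mu>\<^sup>2) * sin \<phi>)"
    using arg_cong[OF eq, of "\<lambda>x. x$1"] arg_cong[OF eq, of "\<lambda>x. x$2"] by (simp_all add: sphere_point_def)
  have "0 \<le> norm x * sqrt (1 - \<mu>\<^sup>2)" using mp(1) by (simp add: abs_square_le_1 abs_le_iff)
  then have "\<mu>\<^sup>2 \<noteq> 1" "\<phi> \<noteq> 0" using c(1) by (auto simp: x1 x2)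
  then have "v \<in> spherical_domain"
    using mp(1-3) c(2) x power_Suc_less_one[of "norm x" 2]
    by (auto simp: v_def spherical_domain_def less_le numeral_3_eq_3 numeral_2_eq_2)
  with xv show "x \<in> spherical_coords ` spherical_domain" by blast
qed

section \<open>Surface measure as the volume of cones\<close>

text \<open>The surface measure is given by one particular parametrization, which distinguishes the z-axis. Lebesgue
  measure has no distinguished axis, and this formula transfers that symmetry to the sphere. It holds
  because \<^const>\<open>spherical_coords\<close> maps (interval of length 1) \<open>\<times>\<close> (parameters of \<open>A\<close>), whose volume is the
  surface measure of \<open>A\<close>, onto the cone over \<open>A\<close> up to a null set while dividing volumes by 3.\<close>
lemma surface_measure_eq_cone:
  assumes A [measurable]: "A \<in> sets borel"
  shows "emeasure surface_measure A = 3 * emeasure lborel {x \<in> ball 0 1. sgn x \<in> A}"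
proof -
  define Q :: "(real \<times> real) set" where "Q = {-1<..<1} \<times> {0<..<2*pi}"
  define B where "B = sphere_point -` A \<inter> Q"
  define B' where "B' = sphere_point -` A \<inter> ({-1..1} \<times> {0..2*pi})"
  define S where "S = {v \<in> spherical_domain. (v$2, v$3) \<in> B}"
  define C where "C = {x \<in> ball 0 1. sgn x \<in> A}"
  have spA: "sphere_point -` A \<in> sets borel"
    using measurable_sets[OF measurable_sphere_point A] by simp
  have Q: "Q \<in> sets borel" unfolding Q_def by (intro borel_open open_Times) auto
  have B[measurable]: "B \<in> sets borel" using spA Q by (simp add: B_def)
  have R: "{-1..1} \<times> {0..2*pi} \<in> sets (borel :: (real \<times> real) measure)"
    by (intro borel_closed closed_Times) auto
  then have B'[measurable]: "B' \<in> sets borel" using spA by (simp add: B'_def)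
  have Qfin: "emeasure lborel Q < \<infinity>"
    by (simp add: Q_def emeasure_lborel_Times ennreal_mult_less_top)
  have Bfin: "emeasure lborel B \<noteq> \<infinity>"
    using emeasure_mono[of B Q lborel] Q Qfin by (auto simp: B_def)
  have null: "emeasure lborel (({-1, 1} \<times> UNIV) \<union> (UNIV \<times> {0, 2*pi}) :: (real \<times> real) set) = 0"
  proof -
    have "{-1, 1 :: real} \<times> (UNIV :: real set) \<in> null_sets (lborel \<Otimes>\<^sub>M lborel)"
      "(UNIV :: real set) \<times> {0, 2*pi} \<in> null_sets (lborel \<Otimes>\<^sub>M lborel)"
      by (auto simp: null_sets_def lborel.emeasure_pair_measure_Times emeasure_lborel_countable)
    from null_sets.Un[OF this] show ?thesis by (simp add: lborel_prod null_sets_def)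
  qed
  \<comment> \<open>The surface measure of \<open>A\<close> is the area of \<open>B\<close> in parameter space.\<close>
  have "emeasure surface_measure A = emeasure lborel B'"
    unfolding surface_measure_def using R
    by (subst emeasure_distr) (auto simp: space_restrict_space emeasure_restrict_space B'_def intro!: measurable_restrict_space1)
  also have "\<dots> = emeasure lborel B"
  proof (rule emeasure_eq_AE)
    let ?N = "({-1, 1} \<times> UNIV) \<union> (UNIV \<times> {0, 2*pi}) :: (real \<times> real) set"
    have "?N \<in> null_sets lborel"
      using null by (auto simp: null_sets_def intro!: borel_closed closed_Un closed_Times)
    then show "AE x in lborel. (x \<in> B') = (x \<in> B)"
      by (rule AE_I') (auto simp: B_def B'_def Q_def less_le)
  qed auto
  finally have 1: "emeasure surface_measure A = emeasure lborel B" .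
  \<comment> \<open>This is also the volume of the box-like set \<open>S\<close> ...\<close>
  have Sb[measurable]: "S \<in> sets borel"
  proof -
    have [measurable]: "(\<lambda>v::real^3. v$1) \<in> borel_measurable borel"
      by (intro borel_measurable_continuous_onI continuous_intros)
    have [measurable]: "(\<lambda>v::real^3. (v$2, v$3)) \<in> borel_measurable borel"
      by (intro borel_measurable_continuous_onI continuous_intros)
    have "S = {v \<in> space borel. v$1 \<in> {0<..<1} \<and> (v$2, v$3) \<in> B}"
      by (auto simp: S_def B_def Q_def spherical_domain_def)
    also have "\<dots> \<in> sets borel" by measurable
    finally show ?thesis .
  qed
  have S: "emeasure lborel S = emeasure lborel B"
  proof -
    have "emeasure lborel S = emeasure lborel ((\<lambda>(a, b, c). vector [a, b, c]) -` S)"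
      by (subst lborel_vec3[symmetric], subst emeasure_distr) (simp_all add: case_prod_beta borel_prod[symmetric] space_pair_measure)
    also have "(\<lambda>(a, b, c). vector [a, b, c]) -` S = {0<..<1} \<times> B"
      by (auto simp: S_def spherical_domain_def B_def Q_def)
    also have "emeasure lborel \<dots> = emeasure lborel B"
      by (simp add: emeasure_lborel_Times)
    finally show ?thesis .
  qed
  have Sl: "S \<in> lmeasurable"
    using S Bfin Sb by (auto simp: fmeasurable_def less_top)
  \<comment> \<open>... which the change of variables maps onto \<open>C\<close> up to a null set, shrinking volumes by 3.\<close>
  have "\<exists>D. (spherical_coords has_derivative D) (at v within S) \<and> \<bar>Determinants.det (matrix D)\<bar> = 1/3"
    if "v \<in> S" for v
    using that spherical_coords_derivative[of v S] by (auto simp: S_def spherical_domain_def)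
  then have "\<exists>D. \<forall>v\<in>S. (spherical_coords has_derivative D v) (at v within S) \<and> \<bar>Determinants.det (matrix (D v))\<bar> = 1/3"
    by (intro bchoice) blast
  then obtain D where D: "\<And>v. v \<in> S \<Longrightarrow> (spherical_coords has_derivative D v) (at v within S)"
      "\<And>v. v \<in> S \<Longrightarrow> \<bar>Determinants.det (matrix (D v))\<bar> = 1/3" by blast
  have "((\<lambda>v. 1/3 * indicator S v) has_integral (1/3 * measure lebesgue S)) UNIV"
    by (rule has_integral_mult_right[OF lmeasurable_iff_has_integral[THEN iffD1, OF Sl]])
  also have "(\<lambda>v. 1/3 * indicator S v) = (\<lambda>v. if v \<in> S then 1/3 else 0 :: real)"
    by (simp add: fun_eq_iff)
  finally have "((\<lambda>v. 1/3) has_integral (measure lebesgue S / 3)) S"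
    unfolding has_integral_restrict_UNIV by (rule has_integral_eq_rhs) (simp only: times_divide_eq_left mult_1_left)
  then have "((\<lambda>v. \<bar>Determinants.det (matrix (D v))\<bar>) has_integral (measure lebesgue S / 3)) S"
    using D(2) by (subst has_integral_cong[where g="\<lambda>v. 1/3"]) auto
  moreover have "inj_on spherical_coords S"
    by (rule inj_on_subset[OF inj_on_spherical_coords]) (auto simp: S_def)
  moreover have "S \<in> sets lebesgue" using Sl by (simp add: fmeasurable_def)
  ultimately have im: "spherical_coords ` S \<in> lmeasurable \<and>
      measure lebesgue (spherical_coords ` S) = measure lebesgue S / 3"
    using has_measure_differentiable_image[of S spherical_coords D "measure lebesgue S / 3"] D(1) by blast
  have imS: "spherical_coords ` S = (spherical_coords ` spherical_domain) \<inter> {x. sgn x \<in> A}"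
    using sgn_spherical_coords by (auto simp: S_def B_def Q_def spherical_domain_def)
  have Cb[measurable]: "C \<in> sets borel" unfolding C_def by measurable
  have "emeasure lborel C = emeasure lebesgue C" by simp
  also have "\<dots> = emeasure lebesgue (spherical_coords ` S)"
  proof (rule emeasure_eq_AE)
    have "{x::real^3. x$2 = 0} \<in> null_sets lebesgue"
      using negligible_standard_hyperplane_cart negligible_iff_null_sets by blast
    then show "AE x in lebesgue. (x \<in> C) = (x \<in> spherical_coords ` S)"
      by (rule AE_I') (auto simp: imS spherical_coords_image C_def)
  qed (use im in auto)
  also have "\<dots> = ennreal (measure lebesgue S / 3)"
    using im by (simp add: emeasure_eq_measure2)
  also have "\<dots> = ennreal (measure lebesgue S) / 3"
    by (subst divide_ennreal[symmetric]) auto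
  also have "ennreal (measure lebesgue S) = emeasure lborel S"
    using emeasure_eq_ennreal_measure[of lborel S] S Bfin Sb by simp
  finally have C3: "emeasure lborel C = emeasure lborel B / 3" by (simp only: S)
  show ?thesis
    unfolding 1 C_def[symmetric] C3
    by (simp add: ennreal_times_divide mult_divide_eq_ennreal mult.commute[of 3])
qed

lemma emeasure_cone:
  assumes [measurable]: "A \<in> sets borel"
  shows "{x \<in> ball 0 1. sgn x \<in> A} \<in> lmeasurable"
    and "emeasure surface_measure A = 3 * ennreal (measure lebesgue {x \<in> ball 0 1. sgn x \<in> A})"
proof -
  let ?C = "{x \<in> ball 0 1. sgn x \<in> A}"
  have b: "?C \<in> sets borel" by measurable
  show l: "?C \<in> lmeasurable"
    using b by (intro bounded_set_imp_lmeasurable bounded_subset[OF bounded_ball[of 0 1]]) auto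
  have "emeasure lborel ?C = emeasure lebesgue ?C" using b by simp
  also have "\<dots> = ennreal (measure lebesgue ?C)" using l by (rule emeasure_eq_measure2)
  finally show "emeasure surface_measure A = 3 * ennreal (measure lebesgue ?C)"
    using surface_measure_eq_cone[OF assms] by simp
qed

lemma sets_surface_measure [simp, measurable_cong]: "sets surface_measure = sets borel"
  and space_surface_measure [simp]: "space surface_measure = UNIV"
  by (simp_all add: surface_measure_def)

interpretation surface: finite_measure surface_measure
  by (rule finite_measureI) (use emeasure_cone(2)[of UNIV] in \<open>simp add: ennreal_mult_eq_top_iff\<close>)

text \<open>An orthogonal map takes the cone over a set to the cone over its image and preserves volume.\<close>
lemma surface_measure_orthogonal:
  fixes R :: "real^3 \<Rightarrow> real^3"
  assumes R: "orthogonal_transformation R"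
  shows "distr surface_measure borel R = surface_measure"
proof (rule measure_eqI)
  have lin: "linear R" using R by (rule orthogonal_transformation_linear)
  have [measurable]: "R \<in> borel_measurable borel"
    by (intro borel_measurable_continuous_onI linear_continuous_on lin[unfolded linear_conv_bounded_linear])
  fix A assume "A \<in> sets (distr surface_measure borel R)"
  then have A[measurable]: "A \<in> sets borel" by simp
  then have RA: "R -` A \<in> sets borel" using measurable_sets[of R borel borel A] by simp
  have "{x \<in> ball 0 1. sgn x \<in> A} = R ` {x \<in> ball 0 1. sgn x \<in> R -` A}"
  proof -
    have "sgn (R x) = R (sgn x)" for x
      using R by (simp add: sgn_div_norm orthogonal_transformation_norm orthogonal_transformation_scaleR)
    moreover have "surj R" using R by (rule orthogonal_transformation_surj)
    ultimately show ?thesis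
      using orthogonal_transformation_norm[OF R] by (auto simp: image_iff) (metis surjD)
  qed
  then have "measure lebesgue {x \<in> ball 0 1. sgn x \<in> A} = measure lebesgue {x \<in> ball 0 1. sgn x \<in> R -` A}"
    using measure_orthogonal_image[OF R emeasure_cone(1)[OF RA]] by simp
  then show "emeasure (distr surface_measure borel R) A = emeasure surface_measure A"
    by (simp add: emeasure_distr emeasure_cone(2)[OF A] emeasure_cone(2)[OF RA])
qed simp

lemma AE_norm_surface_measure: "AE x in surface_measure. norm x = 1"
proof (rule AE_I')
  have "{x \<in> ball 0 1. sgn x \<in> {x::real^3. norm x \<noteq> 1}} = {0}"
    by (auto simp: norm_sgn)
  then show "{x::real^3. norm x \<noteq> 1} \<in> null_sets surface_measure"
    using emeasure_cone(2)[of "{x. norm x \<noteq> 1}"] by (simp add: null_sets_def)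
qed auto

text \<open>The cone over a great circle lies in a plane.\<close>
lemma AE_great_circle_surface_measure:
  fixes n :: "real^3"
  assumes "n \<noteq> 0"
  shows "AE x in surface_measure. n \<bullet> x \<noteq> 0"
proof (rule AE_I')
  have "{x \<in> ball 0 1. sgn x \<in> {x. n \<bullet> x = 0}} \<subseteq> {x. n \<bullet> x = 0}"
    by (auto simp: sgn_div_norm)
  moreover have "negligible {x. n \<bullet> x = 0}" using assms by (intro negligible_hyperplane) simp
  ultimately have "measure lebesgue {x \<in> ball 0 1. sgn x \<in> {x. n \<bullet> x = 0}} = 0"
    using negligible_subset negligible_imp_measure0 by blast
  then show "{x. n \<bullet> x = 0} \<in> null_sets surface_measure"
    using emeasure_cone(2)[of "{x. n \<bullet> x = 0}"] by (simp add: null_sets_def)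
qed auto

lemma integrable_surface_measure:
  fixes f :: "real^3 \<Rightarrow> real"
  assumes f: "continuous_on UNIV f"
  shows "integrable surface_measure f"
proof -
  have "compact (f ` sphere 0 1)"
    by (intro compact_continuous_image continuous_on_subset[OF f]) auto
  then obtain K where "\<forall>y\<in>f ` sphere 0 1. norm y \<le> K"
    using compact_imp_bounded bounded_iff by metis
  then have K: "norm (f x) \<le> K" if "norm x = 1" for x using that by simp
  show ?thesis
  proof (rule surface.integrable_const_bound)
    show "AE x in surface_measure. norm (f x) \<le> K"
      using AE_norm_surface_measure by eventually_elim (rule K)
    show "f \<in> borel_measurable surface_measure"
      using borel_measurable_continuous_onI[OF f] by simp
  qed
qed

lemma set_integrable_surface_measure:
  fixes f :: "real^3 \<Rightarrow> real"
  assumes "continuous_on UNIV f" "A \<in> sets borel"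
  shows "set_integrable surface_measure A f"
  unfolding set_integrable_def
  using assms by (intro integrable_mult_indicator integrable_surface_measure) auto

lemma integral_surface_measure_orthogonal:
  fixes f :: "real^3 \<Rightarrow> real"
  assumes R: "orthogonal_transformation R" and [measurable]: "f \<in> borel_measurable borel"
  shows "(LINT x|surface_measure. f (R x)) = (LINT x|surface_measure. f x)"
proof -
  have [measurable]: "R \<in> borel_measurable borel"
    using orthogonal_transformation_linear[OF R]
    by (intro borel_measurable_continuous_onI linear_continuous_on) (simp add: linear_conv_bounded_linear)
  have "(LINT x|distr surface_measure borel R. f x) = (LINT x|surface_measure. f (R x))"
    by (rule integral_distr) auto
  then show ?thesis by (simp add: surface_measure_orthogonal[OF R])
qed

text \<open>In parameter space this is the fact that a continuous nonnegative function on a box with vanishing integral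
  is zero; every point of the sphere, poles included, is the image of a parameter in the closed box.\<close>
lemma integral_surface_measure_eq_0:
  fixes f :: "real^3 \<Rightarrow> real"
  assumes f: "continuous_on UNIV f" "\<And>x. f x \<ge> 0" and zero: "(LINT x|surface_measure. f x) = 0"
    and x: "norm x = 1"
  shows "f x = 0"
proof -
  let ?B = "cbox (-1, 0) (1, 2*pi) :: (real \<times> real) set"
  have B: "?B = {-1..1} \<times> {0..2*pi}" by (simp add: cbox_Pair_eq)
  have [measurable]: "f \<in> borel_measurable borel" using f(1) by (rule borel_measurable_continuous_onI)
  have cont: "continuous_on A sphere_point" for A
  proof -
    have "sphere_point = (\<lambda>p. (sqrt (1 - (fst p)\<^sup>2) * cos (snd p)) *\<^sub>R axis 1 1
        + (sqrt (1 - (fst p)\<^sup>2) * sin (snd p)) *\<^sub>R axis 2 1 + fst p *\<^sub>R axis 3 1)"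
      by (auto simp: sphere_point_def fun_eq_iff Finite_Cartesian_Product.vec_eq_iff forall_3 axis_def)
    moreover have "continuous_on A \<dots>" by (intro continuous_intros)
    ultimately show ?thesis by (simp only:)
  qed
  have fc: "continuous_on ?B (\<lambda>p. f (sphere_point p))"
    by (rule continuous_on_compose2[OF f(1) cont]) auto
  have "(LINT x|surface_measure. f x) = (LINT p|restrict_space lborel ?B. f (sphere_point p))"
    unfolding surface_measure_def B by (rule integral_distr) (auto intro!: measurable_restrict_space1)
  also have "\<dots> = (LINT p:?B|lborel. f (sphere_point p))"
    by (subst integral_restrict_space) (auto simp: set_lebesgue_integral_def)
  also have "\<dots> = integral ?B (\<lambda>p. f (sphere_point p))"
    by (intro set_borel_integral_eq_integral borel_integrable_compact[OF _ fc, folded set_integrable_def]) auto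
  finally have "integral ?B (\<lambda>p. f (sphere_point p)) = 0" by (simp only: zero)
  then have "\<forall>p\<in>?B. f (sphere_point p) = 0"
    by (subst integral_cbox_eq_0_iff[symmetric]) (auto simp: fc f(2) box_ne_empty Basis_prod_def)
  moreover obtain \<mu> \<phi> where "\<mu> \<in> {-1..1}" "0 \<le> \<phi>" "\<phi> < 2 * pi" "x = sphere_point (\<mu>, \<phi>)"
    by (rule sphere_point_cases[OF x])
  ultimately show ?thesis by (auto simp: B)
qed

section \<open>The reflection form on the hemisphere\<close>
lemma inner_reflect:
  assumes "norm n = 1"
  shows "n \<bullet> reflect n x = - (n \<bullet> x)"
proof -
  have "n \<bullet> n = 1" using assms by (simp add: dot_square_norm)
  then show ?thesis by (simp add: reflect_def inner_diff_right)
qed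

lemma orthogonal_reflect:
  assumes "norm n = 1"
  shows "orthogonal_transformation (reflect n)"
proof -
  have "n \<bullet> n = 1" using assms by (simp add: dot_square_norm)
  moreover have "linear (reflect n)"
    by (rule linearI) (simp_all add: reflect_def inner_add_right algebra_simps)
  moreover have "reflect n v \<bullet> reflect n w = v \<bullet> w + (4 * (n \<bullet> v) * (n \<bullet> w)) * (n \<bullet> n - 1)" for v w
    by (simp add: reflect_def inner_diff_left inner_diff_right inner_commute[of v n] inner_commute[of w n] algebra_simps)
  ultimately show ?thesis
    by (simp add: orthogonal_transformation_def)
qed

text \<open>Let \<open>E\<close> be the integral of \<open>f\<^sup>2\<close> over the hemisphere. The reflection exchanges the two hemispheres, but
  followed by the antipodal map it is a rotation that preserves each of them; as \<open>f\<^sup>2\<close> does not see the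
  antipodal map, \<open>(f \<circ> reflect n)\<^sup>2\<close> has integral \<open>E\<close> as well. Since \<open>\<bar>ab\<bar> \<le> (a\<^sup>2 + b\<^sup>2) / 2\<close>, the form is therefore
  at least \<open>(1 - \<bar>\<rho>\<bar>) E\<close>, and its vanishing forces \<open>E = 0\<close>. By oddness the opposite hemisphere contributes \<open>E\<close>
  too, so \<open>f\<^sup>2\<close> has integral \<open>0\<close> over the whole sphere.\<close>
lemma hemisphere_form_definite:
  fixes f :: "real^3 \<Rightarrow> real" and n :: "real^3"
  assumes f: "continuous_on UNIV f" and odd: "\<And>x. f (- x) = - f x"
    and n: "norm n = 1" and \<rho>: "\<bar>\<rho>\<bar> < 1"
    and zero: "(LINT x:{x \<in> sphere 0 1. n \<bullet> x < 0}|surface_measure. f x * (f x - \<rho> * f (reflect n x))) = 0"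
    and x: "norm x = 1"
  shows "f x = 0"
proof -
  define H where "H = {x \<in> sphere 0 1. n \<bullet> x < 0}"
  have H[measurable]: "H \<in> sets borel"
  proof -
    have "H = sphere 0 1 \<inter> {x. n \<bullet> x < 0}" by (auto simp: H_def)
    then show ?thesis by (auto intro!: sets.Int borel_closed borel_open open_halfspace_lt)
  qed
  have r: "orthogonal_transformation (reflect n)" using n by (rule orthogonal_reflect)
  have cr: "continuous_on UNIV (\<lambda>x. f (reflect n x))"
    by (rule continuous_on_compose2[OF f]) (auto simp: reflect_def intro!: continuous_intros)
  have f2: "(\<lambda>x. (f x)\<^sup>2) \<in> borel_measurable borel"
    by (intro borel_measurable_continuous_onI continuous_intros f)
  define E where "E = (LINT x:H|surface_measure. (f x)\<^sup>2)"
  define E' where "E' = (LINT x:H|surface_measure. (f (reflect n x))\<^sup>2)"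
  have "E' = E"
  proof -
    \<comment> \<open>This is the rotation by \<open>\<pi>\<close> about \<open>n\<close>.\<close>
    have R: "orthogonal_transformation (\<lambda>x. - reflect n x)"
      using r by (simp add: orthogonal_transformation_neg)
    have ind: "indicator H (- reflect n x) = (indicator H x :: real)" for x
      using inner_reflect[OF n, of x] orthogonal_transformation_norm[OF r, of x]
      by (simp add: H_def indicator_def)
    have "E = (LINT x|surface_measure. indicator H (- reflect n x) * (f (- reflect n x))\<^sup>2)"
      unfolding E_def set_lebesgue_integral_def
      by (subst integral_surface_measure_orthogonal[OF R]) (use f2 in auto)
    then show ?thesis by (simp add: ind odd E'_def set_lebesgue_integral_def)
  qed
  have int: "set_integrable surface_measure H (\<lambda>x. (f x)\<^sup>2)"
      "set_integrable surface_measure H (\<lambda>x. (f (reflect n x))\<^sup>2)"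
      "set_integrable surface_measure H (\<lambda>x. f x * (f x - \<rho> * f (reflect n x)))"
    by (intro set_integrable_surface_measure continuous_intros f cr H)+
  have "E - \<bar>\<rho>\<bar> * ((E + E') / 2)
      = (LINT x:H|surface_measure. (f x)\<^sup>2 - \<bar>\<rho>\<bar> * (((f x)\<^sup>2 + (f (reflect n x))\<^sup>2) / 2))"
    using int by (simp add: E_def E'_def set_integral_diff set_integral_add)
  also have "\<dots> \<le> (LINT x:H|surface_measure. f x * (f x - \<rho> * f (reflect n x)))"
  proof (rule set_integral_mono)
    fix x
    let ?a = "f x" and ?b = "f (reflect n x)"
    have "\<rho> * (?a * ?b) \<le> \<bar>\<rho>\<bar> * \<bar>?a * ?b\<bar>" by (metis abs_ge_self abs_mult)
    also have "\<dots> \<le> \<bar>\<rho>\<bar> * ((?a\<^sup>2 + ?b\<^sup>2) / 2)"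
      using sum_squares_bound[of "\<bar>?a\<bar>" "\<bar>?b\<bar>"] by (intro mult_left_mono) (simp_all add: abs_mult)
    finally show "?a\<^sup>2 - \<bar>\<rho>\<bar> * ((?a\<^sup>2 + ?b\<^sup>2) / 2) \<le> ?a * (?a - \<rho> * ?b)"
      by (simp add: right_diff_distrib power2_eq_square mult.left_commute[of ?a \<rho>])
  qed (use int in auto)
  also have "\<dots> = 0" using zero by (simp add: H_def)
  finally have "(1 - \<bar>\<rho>\<bar>) * E \<le> 0" by (simp add: \<open>E' = E\<close> algebra_simps)
  then have "E \<le> 0" using \<rho> by (simp add: mult_le_0_iff)
  moreover have "E \<ge> 0" unfolding E_def set_lebesgue_integral_def by (rule integral_nonneg_AE) auto
  ultimately have "E = 0" by simp
  have u: "orthogonal_transformation (\<lambda>x::real^3. - x)"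
    by (simp add: orthogonal_transformation_neg)
  have E2: "(LINT x|surface_measure. indicator H (- x) * (f x)\<^sup>2) = E"
  proof -
    have "E = (LINT x|surface_measure. indicator H (- x) * (f (- x))\<^sup>2)"
      unfolding E_def set_lebesgue_integral_def
      by (subst integral_surface_measure_orthogonal[OF u]) (use f2 in auto)
    then show ?thesis by (simp add: odd)
  qed
  have "(LINT x|surface_measure. (f x)\<^sup>2)
      = (LINT x|surface_measure. indicator H x * (f x)\<^sup>2 + indicator H (- x) * (f x)\<^sup>2)"
  proof (rule integral_cong_AE)
    have "n \<noteq> 0" using n by auto
    show "AE x in surface_measure. (f x)\<^sup>2 = indicator H x * (f x)\<^sup>2 + indicator H (- x) * (f x)\<^sup>2"
      using AE_norm_surface_measure AE_great_circle_surface_measure[OF \<open>n \<noteq> 0\<close>]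
      by eventually_elim (auto simp: H_def indicator_def)
  qed (use f2 in measurable)
  also have "\<dots> = E + E"
  proof -
    have i2: "integrable surface_measure (\<lambda>x. (f x)\<^sup>2)"
      by (intro integrable_surface_measure continuous_intros f)
    have i: "integrable surface_measure (\<lambda>x. indicator A x * (f x)\<^sup>2)" if "A \<in> sets borel" for A
      using integrable_mult_indicator[OF _ i2, of A] that by simp
    have "(\<lambda>x. - x) -` H \<in> sets borel" using measurable_sets[of "\<lambda>x. - x" borel borel H] by simp
    moreover have "indicator H (- x) = (indicator ((\<lambda>x. - x) -` H) x :: real)" for x
      by (simp add: indicator_def)
    ultimately have "integrable surface_measure (\<lambda>x. indicator H (- x) * (f x)\<^sup>2)" using i by simp
    then show ?thesis
      using i[OF H] E2 by (simp add: E_def set_lebesgue_integral_def)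
  qed
  finally have "(LINT x|surface_measure. (f x)\<^sup>2) = 0" using \<open>E = 0\<close> by simp
  then have "(f x)\<^sup>2 = 0"
    by (rule integral_surface_measure_eq_0[where f = "\<lambda>x. (f x)\<^sup>2", rotated 2, OF _ x])
      (auto intro!: continuous_intros f)
  then show ?thesis by simp
qed

section \<open>Spherical harmonics as polynomials\<close>

text \<open>The polynomial factor of the associated Legendre function, without the normalization and without the
  power of \<open>sqrt (1 - \<mu>\<^sup>2)\<close>.\<close>
definition legendre_factor :: "nat \<Rightarrow> nat \<Rightarrow> real poly" where
  "legendre_factor l m = (pderiv ^^ (l + m)) ([:-1, 0, 1:] ^ l)"

text \<open>For \<open>w = s * cis \<phi>\<close> this is \<open>s\<^bsup>\<bar>m\<bar>\<^esup>\<close> times the azimuthal factor of the spherical harmonic. Taking \<open>w = x + iy\<close>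
  absorbs the power of \<open>s = sqrt (1 - \<mu>\<^sup>2)\<close> and leaves a polynomial in the Cartesian coordinates.\<close>
definition azimuthal :: "int \<Rightarrow> complex \<Rightarrow> real" where
  "azimuthal m w = (if m > 0 then sqrt 2 * Re (w ^ nat m) else if m = 0 then 1
     else sqrt 2 * Im (w ^ nat \<bar>m\<bar>))"

definition harm_const :: "nat \<Rightarrow> nat \<Rightarrow> real" where
  "harm_const l m = sqrt ((2 * real l + 1) / (4 * pi) * (fact (l - m) / fact (l + m))) / (2 ^ l * fact l)"

text \<open>A polynomial on the whole space that restricts to the spherical harmonic on the sphere. It replaces
  \<^const>\<open>sph_harm\<close>, whose formula with \<^const>\<open>Arg2pi\<close> hides continuity and parity.\<close>
definition poly_harm :: "nat \<Rightarrow> int \<Rightarrow> real^3 \<Rightarrow> real" where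
  "poly_harm l m x = harm_const l (nat \<bar>m\<bar>) * poly (legendre_factor l (nat \<bar>m\<bar>)) (x $ 3)
     * azimuthal m (Complex (x $ 1) (x $ 2))"

lemma higher_deriv_poly: "(deriv ^^ k) (poly p) = poly ((pderiv ^^ k) p)"
  for p :: "real poly"
proof (induction k arbitrary: p)
  case (Suc k)
  have "deriv (poly p) = poly (pderiv p)" for p :: "real poly"
    by (intro ext DERIV_imp_deriv poly_DERIV)
  with Suc show ?case by (simp add: funpow_Suc_right del: funpow.simps)
qed simp

lemma assoc_legendre_eq:
  "assoc_legendre l m \<mu> = 1 / (2 ^ l * fact l) * sqrt (1 - \<mu>\<^sup>2) ^ m * poly (legendre_factor l m) \<mu>"
proof -
  have "(\<lambda>x::real. (x\<^sup>2 - 1) ^ l) = poly ([:-1, 0, 1:] ^ l)"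
    by (auto simp: fun_eq_iff poly_power power2_eq_square)
  then show ?thesis by (simp add: assoc_legendre_def higher_deriv_poly legendre_factor_def)
qed

lemma azimuthal_mult_of_real:
  "azimuthal m (of_real s * w) = s ^ nat \<bar>m\<bar> * azimuthal m w"
  by (simp add: azimuthal_def power_mult_distrib flip: of_real_power)

lemma poly_harm_sphere_point:
  "poly_harm l m (sphere_point (\<mu>, \<phi>)) =
     harm_const l (nat \<bar>m\<bar>) * poly (legendre_factor l (nat \<bar>m\<bar>)) \<mu>
     * (sqrt (1 - \<mu>\<^sup>2) ^ nat \<bar>m\<bar> * azimuthal m (cis \<phi>))"
proof -
  have "Complex (sqrt (1 - \<mu>\<^sup>2) * cos \<phi>) (sqrt (1 - \<mu>\<^sup>2) * sin \<phi>) = of_real (sqrt (1 - \<mu>\<^sup>2)) * cis \<phi>"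
    by (simp add: complex_eq_iff)
  then show ?thesis
    by (simp add: poly_harm_def sphere_point_def azimuthal_mult_of_real)
qed

lemma real_sph_harm_eq: "real_sph_harm l m \<mu> \<phi> = poly_harm l m (sphere_point (\<mu>, \<phi>))"
  by (auto simp: real_sph_harm_def poly_harm_sphere_point Theta_def assoc_legendre_eq harm_const_def
      azimuthal_def Complex.DeMoivre)

lemma continuous_on_poly_harm: "continuous_on A (poly_harm l m)"
proof -
  have "continuous_on A (\<lambda>x::real^3. azimuthal m (Complex (x $ 1) (x $ 2)))"
    unfolding azimuthal_def Complex_eq
    by (cases "m > 0"; cases "m = 0") (auto intro!: continuous_intros)
  then show ?thesis
    unfolding poly_harm_def by (intro continuous_intros) auto
qed

lemma poly_pderiv_parity:
  fixes p :: "real poly"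
  assumes "\<And>x. poly p (- x) = poly p x"
  shows "poly ((pderiv ^^ k) p) (- x) = (-1) ^ k * poly ((pderiv ^^ k) p) x"
proof (induction k arbitrary: x)
  case (Suc k)
  let ?q = "(pderiv ^^ k) p"
  have "pcompose ?q [:0, -1:] = Polynomial.smult ((-1) ^ k) ?q"
    by (rule poly_ext) (simp add: poly_pcompose Suc)
  then have "pderiv (pcompose ?q [:0, -1:]) = pderiv (Polynomial.smult ((-1) ^ k) ?q)" by simp
  then have "poly (pderiv (pcompose ?q [:0, -1:])) x = poly (pderiv (Polynomial.smult ((-1) ^ k) ?q)) x" by simp
  then show ?case by (simp add: pderiv_pcompose pderiv_smult poly_pcompose pderiv_pCons)
qed (simp add: assms)

text \<open>The \<open>(l + \<bar>m\<bar>)\<close>-th derivative of an even polynomial has the parity of \<open>l + \<bar>m\<bar>\<close>, and the factor in \<open>x + iy\<close> is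
  homogeneous of degree \<open>\<bar>m\<bar>\<close>.\<close>
lemma poly_harm_uminus:
  "poly_harm l m (- x) = (-1) ^ l * poly_harm l m x"
proof -
  have 1: "poly (legendre_factor l k) (- y) = (-1) ^ (l + k) * poly (legendre_factor l k) y" for k y
    unfolding legendre_factor_def by (rule poly_pderiv_parity) (simp add: poly_power)
  have cm: "Complex (- a) (- b) = - Complex a b" for a b by (simp add: complex_eq_iff)
  have 2: "azimuthal m (Complex (- a) (- b)) = (-1) ^ nat \<bar>m\<bar> * azimuthal m (Complex a b)" for a b
    using azimuthal_mult_of_real[of m "-1" "Complex a b"] by (simp add: cm)
  show ?thesis by (simp add: poly_harm_def 1 2 power_add)
qed

lemma higher_pderiv_degree:
  fixes p :: "real poly"
  assumes "p \<noteq> 0" "k \<le> degree p"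
  shows "(pderiv ^^ k) p \<noteq> 0 \<and> degree ((pderiv ^^ k) p) = degree p - k"
  using assms(2)
proof (induction k)
  case (Suc k)
  then show ?case by (auto simp: pderiv_eq_0_iff degree_pderiv)
qed (simp add: assms)

lemma legendre_factor_degree:
  assumes "m \<le> l"
  shows "legendre_factor l m \<noteq> 0" "degree (legendre_factor l m) = l - m"
proof -
  have "degree ([:-1, 0, 1:] ^ l :: real poly) = 2 * l" by (simp add: degree_power_eq)
  then show "legendre_factor l m \<noteq> 0" "degree (legendre_factor l m) = l - m"
    using higher_pderiv_degree[of "[:-1, 0, 1:] ^ l" "l + m"] assms
    by (auto simp: legendre_factor_def)
qed

section \<open>Linear independence of the spherical harmonics\<close>

text \<open>The leading coefficient of the term of largest degree that occurs cannot be cancelled.\<close>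
lemma independent_of_distinct_degrees:
  fixes p :: "'i \<Rightarrow> 'a::field poly"
  assumes "finite I" "\<And>i. i \<in> I \<Longrightarrow> p i \<noteq> 0" "inj_on (\<lambda>i. degree (p i)) I"
    and sum0: "(\<Sum>i\<in>I. Polynomial.smult (c i) (p i)) = 0" and "i \<in> I"
  shows "c i = 0"
proof (rule ccontr)
  assume "c i \<noteq> 0"
  define J where "J = {i \<in> I. c i \<noteq> 0}"
  have J: "finite J" "i \<in> J" using assms \<open>c i \<noteq> 0\<close> by (auto simp: J_def)
  then have "Max ((\<lambda>i. degree (p i)) ` J) \<in> (\<lambda>i. degree (p i)) ` J" by (intro Max_in) auto
  then obtain j where j: "j \<in> J" "degree (p j) = Max ((\<lambda>i. degree (p i)) ` J)" by auto
  have "coeff (Polynomial.smult (c i) (p i)) (degree (p j)) = (if i = j then c j * lead_coeff (p j) else 0)" if "i \<in> I" for i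
  proof (cases "i \<in> J \<and> i \<noteq> j")
    case True
    then have "degree (p i) \<le> degree (p j)" using J j(2) by simp
    moreover have "degree (p i) \<noteq> degree (p j)"
      using assms(3) j(1) True by (auto simp: J_def dest: inj_onD)
    ultimately show ?thesis using True by (simp add: coeff_eq_0)
  qed (use that in \<open>auto simp: J_def\<close>)
  then have "coeff (\<Sum>i\<in>I. Polynomial.smult (c i) (p i)) (degree (p j)) = (\<Sum>i\<in>I. if i = j then c j * lead_coeff (p j) else 0)"
    unfolding coeff_sum by (intro sum.cong refl)
  then have "c j * lead_coeff (p j) = 0"
    using sum0 assms(1) j(1) by (simp add: J_def)
  then show False using j(1) assms(2) by (simp add: J_def)
qed

text \<open>After multiplication by \<open>z\<^sup>K\<close> with \<open>K\<close> large, a trigonometric polynomial becomes an ordinary complex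
  polynomial in \<open>z = cis t\<close>. It has infinitely many roots, so all its coefficients vanish. The coefficient at
  \<open>K + k\<close>, for \<open>k > 0\<close>, has a nonzero multiple of the coefficient of \<open>cos (k t)\<close> as real part and one of that of
  \<open>sin (k t)\<close> as imaginary part.\<close>
lemma trig_independent:
  fixes a :: "int \<Rightarrow> real"
  assumes M: "finite M" and zero: "\<And>t. t \<in> {0..2*pi} \<Longrightarrow> (\<Sum>m\<in>M. a m * azimuthal m (cis t)) = 0"
    and "k \<in> M"
  shows "a k = 0"
proof -
  define K where "K = (\<Sum>m\<in>M. nat \<bar>m\<bar>)"
  have K: "nat \<bar>m\<bar> \<le> K" if "m \<in> M" for m
    using member_le_sum[of m M "\<lambda>m. nat \<bar>m\<bar>"] M that by (simp add: K_def)
  define \<beta> where "\<beta> = complex_of_real (sqrt 2 / 2)"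
  \<comment> \<open>\<open>q m\<close> takes the value \<open>z^K * azimuthal m z\<close> on the unit circle, where \<open>cnj z = 1 / z\<close>.\<close>
  define q :: "int \<Rightarrow> complex poly" where
    "q m = (if m > 0 then monom \<beta> (K + nat m) + monom \<beta> (K - nat m)
       else if m = 0 then monom 1 K
       else monom (- \<i> * \<beta>) (K + nat \<bar>m\<bar>) + monom (\<i> * \<beta>) (K - nat \<bar>m\<bar>))" for m
  have qp: "poly (q m) z = z ^ K * of_real (azimuthal m z)" if "cmod z = 1" "m \<in> M" for z m
  proof -
    define k where "k = nat \<bar>m\<bar>"
    have z0: "z \<noteq> 0" and zz: "inverse z = cnj z"
      using that(1) by (auto intro!: inverse_unique simp: complex_norm_square[symmetric])
    have down: "z ^ (K - k) = z ^ K * cnj (z ^ k)"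
      using K[OF that(2)] z0 by (simp add: k_def power_diff divide_inverse flip: zz power_inverse)
    consider "m > 0" | "m = 0" | "m < 0" by linarith
    then show ?thesis
    proof cases
      case 1
      then have "poly (q m) z = \<beta> * z ^ K * (z ^ k + cnj (z ^ k))"
        using down by (simp add: q_def poly_monom power_add distrib_left mult.assoc k_def del: complex_add_cnj)
      also have "\<dots> = z ^ K * of_real (azimuthal m z)"
        using 1 by (simp only: complex_add_cnj) (simp add: \<beta>_def azimuthal_def k_def)
      finally show ?thesis .
    next
      case 2
      then show ?thesis by (simp add: q_def poly_monom azimuthal_def)
    next
      case 3
      then have "\<not> m > 0" "m \<noteq> 0" by auto
      then have "poly (q m) z = - \<i> * \<beta> * z ^ K * (z ^ k - cnj (z ^ k))"
        using down by (simp add: q_def poly_monom power_add right_diff_distrib mult.assoc k_def del: complex_diff_cnj)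
      also have "\<dots> = z ^ K * of_real (azimuthal m z)"
        using 3 by (simp only: complex_diff_cnj) (simp add: \<beta>_def azimuthal_def k_def algebra_simps)
      finally show ?thesis .
    qed
  qed
  define P where "P = (\<Sum>m\<in>M. Polynomial.smult (of_real (a m)) (q m))"
  have root: "poly P (cis t) = 0" if "t \<in> {0..2*pi}" for t
  proof -
    have "poly P (cis t) = (\<Sum>m\<in>M. of_real (a m) * (cis t ^ K * of_real (azimuthal m (cis t))))"
      by (simp add: P_def poly_sum qp)
    also have "\<dots> = cis t ^ K * of_real (\<Sum>m\<in>M. a m * azimuthal m (cis t))"
      by (simp add: sum_distrib_left mult_ac)
    finally show ?thesis using zero[OF that] by simp
  qed
  have "P = 0"
  proof (rule ccontr)
    assume "P \<noteq> 0"
    then have "finite {z. poly P z = 0}" by (rule poly_roots_finite)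
    then have "finite (cis ` {0..pi})"
      by (rule rev_finite_subset) (use root pi_ge_zero in force)
    moreover have "inj_on cis {0..pi}"
      by (rule inj_onI) (use cos_inj_pi in \<open>force simp: complex_eq_iff\<close>)
    ultimately show False using finite_image_iff infinite_Icc[OF pi_gt_zero] by blast
  qed
  \<comment> \<open>\<open>\<gamma> m\<close> is the coefficient of the upper monomial of \<open>q m\<close>; the lower one, present for \<open>m \<noteq> 0\<close>, has degree below \<open>K\<close>.\<close>
  define \<gamma> where "\<gamma> m = (if m > 0 then \<beta> else if m = 0 then 1 else - \<i> * \<beta>)" for m :: int
  have "coeff (q m) (K + nat \<bar>k\<bar>) = (if m = k \<or> m = - k then \<gamma> m else 0)" if "m \<in> M" for m
  proof -
    have low: "K - nat \<bar>m\<bar> = K + nat \<bar>k\<bar> \<longleftrightarrow> m = 0 \<and> k = 0" and high: "nat \<bar>m\<bar> = nat \<bar>k\<bar> \<longleftrightarrow> m = k \<or> m = - k"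
      using K[OF that] by linarith+
    consider "m > 0" | "m = 0" | "m < 0" by linarith
    then show ?thesis
    proof cases
      case 1
      then have "q m = monom \<beta> (K + nat \<bar>m\<bar>) + monom \<beta> (K - nat \<bar>m\<bar>)" by (simp add: q_def)
      then show ?thesis using 1 by (simp only: coeff_add coeff_monom low add_left_cancel high) (simp add: \<gamma>_def)
    next
      case 2
      then show ?thesis by (auto simp: q_def \<gamma>_def)
    next
      case 3
      then have "q m = monom (- \<i> * \<beta>) (K + nat \<bar>m\<bar>) + monom (\<i> * \<beta>) (K - nat \<bar>m\<bar>)" by (simp add: q_def)
      then show ?thesis using 3 by (simp only: coeff_add coeff_monom low add_left_cancel high) (simp add: \<gamma>_def)
    qed
  qed
  then have "(\<Sum>m\<in>M. of_real (a m) * (if m = k \<or> m = - k then \<gamma> m else 0)) = coeff P (K + nat \<bar>k\<bar>)"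
    by (simp add: P_def coeff_sum)
  then have z: "(\<Sum>m\<in>M. of_real (a m) * (if m = k \<or> m = - k then \<gamma> m else 0)) = 0"
    by (simp add: \<open>P = 0\<close>)
  show ?thesis
  proof (cases "k < 0")
    case True
    have "0 = (\<Sum>m\<in>M. Im (of_real (a m) * (if m = k \<or> m = - k then \<gamma> m else 0)))"
      using arg_cong[OF z, of Im] by (simp only: Im_sum zero_complex.sel)
    also have "\<dots> = (\<Sum>m\<in>M. if m = k then - (a k * (sqrt 2 / 2)) else 0)"
      using True by (intro sum.cong refl) (auto simp: \<gamma>_def \<beta>_def)
    also have "\<dots> = - (a k * (sqrt 2 / 2))" using M \<open>k \<in> M\<close> by simp
    finally show ?thesis by simp
  next
    case False
    define w where "w = (if k = 0 then 1 else sqrt 2 / 2)"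
    have "0 = (\<Sum>m\<in>M. Re (of_real (a m) * (if m = k \<or> m = - k then \<gamma> m else 0)))"
      using arg_cong[OF z, of Re] by (simp only: Re_sum zero_complex.sel)
    also have "\<dots> = (\<Sum>m\<in>M. if m = k then a k * w else 0)"
      using False by (intro sum.cong refl) (auto simp: \<gamma>_def \<beta>_def w_def)
    also have "\<dots> = a k * w" using M \<open>k \<in> M\<close> by simp
    finally show ?thesis by (simp add: w_def split: if_splits)
  qed
qed

text \<open>For fixed \<open>\<mu>\<close> independence in \<open>\<phi>\<close> separates the orders \<open>m\<close>. For fixed \<open>m\<close> the Legendre factors have the distinct
  degrees \<open>l - \<bar>m\<bar>\<close>.\<close>
lemma poly_harm_independent:
  fixes c :: "nat \<times> int \<Rightarrow> real"
  assumes I: "finite I" "\<And>l m. (l, m) \<in> I \<Longrightarrow> nat \<bar>m\<bar> \<le> l"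
    and zero: "\<And>\<mu> \<phi>. \<mu> \<in> {-1..1} \<Longrightarrow> \<phi> \<in> {0..2*pi} \<Longrightarrow>
      (\<Sum>(l, m)\<in>I. c (l, m) * poly_harm l m (sphere_point (\<mu>, \<phi>))) = 0"
    and "(l0, m0) \<in> I"
  shows "c (l0, m0) = 0"
proof -
  define L where "L m = {l. (l, m) \<in> I}" for m
  have L: "finite (L m)" for m
    by (rule finite_subset[of _ "fst ` I"]) (use I(1) in \<open>force simp: L_def\<close>)+
  define P where "P m = (\<Sum>l\<in>L m. Polynomial.smult (c (l, m) * harm_const l (nat \<bar>m\<bar>)) (legendre_factor l (nat \<bar>m\<bar>)))" for m
  have P0: "poly (P m0) \<mu> = 0" if "\<mu> \<in> {-1<..<1}" for \<mu>
  proof -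
    let ?s = "sqrt (1 - \<mu>\<^sup>2)"
    have "\<mu>\<^sup>2 < 1" using that by (simp add: abs_square_less_1 abs_less_iff)
    then have s: "?s > 0" by simp
    have "(\<Sum>m\<in>snd ` I. (?s ^ nat \<bar>m\<bar> * poly (P m) \<mu>) * azimuthal m (cis \<phi>)) = 0" if "\<phi> \<in> {0..2*pi}" for \<phi>
    proof -
      have "0 = (\<Sum>(l, m)\<in>I. c (l, m) * poly_harm l m (sphere_point (\<mu>, \<phi>)))"
        using zero[of \<mu> \<phi>] that \<open>\<mu> \<in> {-1<..<1}\<close> by simp
      also have "\<dots> = (\<Sum>m\<in>snd ` I. \<Sum>p\<in>{p \<in> I. snd p = m}. case p of (l, m) \<Rightarrow> c (l, m) * poly_harm l m (sphere_point (\<mu>, \<phi>)))"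
        by (rule sum.image_gen[OF I(1)])
      also have "\<dots> = (\<Sum>m\<in>snd ` I. \<Sum>l\<in>L m. c (l, m) * poly_harm l m (sphere_point (\<mu>, \<phi>)))"
        by (rule sum.cong[OF refl], rule sum.reindex_bij_witness[of _ "\<lambda>l. (l, m)" fst for m]) (auto simp: L_def)
      also have "\<dots> = (\<Sum>m\<in>snd ` I. (?s ^ nat \<bar>m\<bar> * poly (P m) \<mu>) * azimuthal m (cis \<phi>))"
        by (simp add: P_def poly_sum poly_harm_sphere_point sum_distrib_left sum_distrib_right mult_ac)
      finally show ?thesis by simp
    qed
    then have "?s ^ nat \<bar>m0\<bar> * poly (P m0) \<mu> = 0"
      by (rule trig_independent[rotated]) (use I(1) \<open>(l0, m0) \<in> I\<close> in force)+
    then show ?thesis using s by simp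
  qed
  have "P m0 = 0"
  proof (rule ccontr)
    assume "P m0 \<noteq> 0"
    then have "finite {x. poly (P m0) x = 0}" by (rule poly_roots_finite)
    then have "finite {-1<..<1::real}" by (rule rev_finite_subset) (use P0 in auto)
    then show False by (simp add: infinite_Ioo)
  qed
  have m0: "nat \<bar>m0\<bar> \<le> l" if "l \<in> L m0" for l using that I(2) by (simp add: L_def)
  have "c (l0, m0) * harm_const l0 (nat \<bar>m0\<bar>) = 0"
  proof (rule independent_of_distinct_degrees[of "L m0" "\<lambda>l. legendre_factor l (nat \<bar>m0\<bar>)" "\<lambda>l. c (l, m0) * harm_const l (nat \<bar>m0\<bar>)" l0])
    show "inj_on (\<lambda>l. degree (legendre_factor l (nat \<bar>m0\<bar>))) (L m0)"
      using m0 by (intro inj_onI) (simp add: legendre_factor_degree eq_diff_iff)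
    show "(\<Sum>l\<in>L m0. Polynomial.smult (c (l, m0) * harm_const l (nat \<bar>m0\<bar>)) (legendre_factor l (nat \<bar>m0\<bar>))) = 0"
      using \<open>P m0 = 0\<close> by (simp only: P_def)
    show "l0 \<in> L m0" using \<open>(l0, m0) \<in> I\<close> by (simp add: L_def)
  qed (simp_all add: L legendre_factor_degree m0)
  moreover have "harm_const l0 (nat \<bar>m0\<bar>) > 0"
    by (simp add: harm_const_def)
  ultimately show ?thesis by simp
qed

section \<open>Invertibility of the matrix\<close>
lemma distinct_concat_map_Pair:
  assumes "distinct ls" "\<And>l. l \<in> set ls \<Longrightarrow> distinct (h l)"
  shows "distinct (concat (map (\<lambda>l. map (Pair l) (h l)) ls))"
  using assms by (induction ls) (auto simp: distinct_map inj_on_def)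

lemma distinct_odd_basis_indices: "distinct (odd_basis_indices g N)"
proof -
  have "concat (map (\<lambda>m. if P m then [(l, m)] else []) ms) = map (Pair l) (filter P ms)"
    for l :: nat and P and ms :: "int list" by (induction ms) auto
  then have "basis_indices g N = concat (map (\<lambda>l. map (Pair l) (filter (in_geometry g l) [- int l..int l])) [0..<Suc N])"
    by (simp add: basis_indices_def del: upt_Suc)
  then have "distinct (basis_indices g N)"
    by (simp add: distinct_concat_map_Pair del: upt_Suc)
  then show ?thesis by (simp add: odd_basis_indices_def)
qed

lemma odd_basis_indices_range:
  assumes "(l, m) \<in> set (odd_basis_indices g N)"
  shows "odd l" "nat \<bar>m\<bar> \<le> l"
  using assms by (auto simp: odd_basis_indices_def basis_indices_def split: if_splits)

lemma odd_basis_nth: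
  assumes "i < num_odd g N" "odd_basis_indices g N ! i = (l, m)" "norm \<Omega> = 1"
  shows "vec_index (odd_basis g N \<Omega>) i = poly_harm l m \<Omega>"
proof -
  obtain \<mu> \<phi> where \<mu>: "\<mu> \<in> {-1..1}" and \<Omega>: "\<Omega> = sphere_point (\<mu>, \<phi>)"
    using sphere_point_cases[OF assms(3)] by metis
  have "sph_harm l m \<Omega> = poly_harm l m \<Omega>"
    by (simp only: \<Omega> sph_harm_sphere_point[OF \<mu>] real_sph_harm_eq)
  then show ?thesis
    using assms(1,2) by (simp add: odd_basis_def num_odd_def vec_of_list_index)
qed

lemma admissible_normal_norm: "admissible_normal g n \<Longrightarrow> norm n = 1"
  by (cases g) (auto simp: norm_vec3)

lemma invertible_mat_if_kernel_trivial:
  fixes A :: "real mat"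
  assumes A: "A \<in> carrier_mat k k"
    and ker: "\<And>v. v \<in> carrier_vec k \<Longrightarrow> A *\<^sub>v v = 0\<^sub>v k \<Longrightarrow> v = 0\<^sub>v k"
  shows "invertible_mat A"
proof -
  have "Determinant.det A \<noteq> 0"
    using det_0_iff_vec_prod_zero_field[OF A] ker by blast
  then have "A \<in> Units (ring_mat TYPE(real) k undefined)"
    by (rule det_non_zero_imp_unit[OF A])
  then obtain B where "B \<in> carrier_mat k k" "B * A = 1\<^sub>m k" "A * B = 1\<^sub>m k"
    by (auto simp: Units_def ring_mat_def)
  then show ?thesis using A
    by (auto simp: invertible_mat_def inverts_mat_def intro!: exI[of _ B])
qed

theorem lemma3p7:
  fixes N :: nat and g :: geometry and n :: "real^3" and \<rho> :: real
  assumes "N > 0" and "odd N"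
    and "admissible_normal g n"
    and "-1 < \<rho>" and "\<rho> < 1"
  shows "invertible_mat (H_odd g N \<rho> n)"
proof (rule invertible_mat_if_kernel_trivial)
  let ?H = "{\<Omega> \<in> sphere 0 1. n \<bullet> \<Omega> < 0}"
  define k where "k = num_odd g N"
  define idx where "idx = odd_basis_indices g N"
  define Y where "Y i = poly_harm (fst (idx ! i)) (snd (idx ! i))" for i
  have k: "k = length idx" by (simp add: k_def idx_def num_odd_def)
  show "H_odd g N \<rho> n \<in> carrier_mat k k" by (simp add: H_odd_def k_def)
  fix v :: "real Matrix.vec" assume v: "v \<in> carrier_vec k" and Hv: "H_odd g N \<rho> n *\<^sub>v v = 0\<^sub>v k"
  define c where "c i = vec_index v i" for i
  define f where "f \<Omega> = (\<Sum>i<k. c i * Y i \<Omega>)" for \<Omega>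
  have n: "norm n = 1" using assms(3) by (rule admissible_normal_norm)
  have Yc: "continuous_on UNIV (Y i)" for i unfolding Y_def by (rule continuous_on_poly_harm)
  have rc: "continuous_on UNIV (\<lambda>\<Omega>. Y i (reflect n \<Omega>))" for i
    by (rule continuous_on_compose2[OF Yc]) (auto simp: reflect_def intro!: continuous_intros)
  have fc: "continuous_on UNIV f" unfolding f_def by (intro continuous_intros Yc)
  have idx: "(fst (idx ! i), snd (idx ! i)) \<in> set (odd_basis_indices g N)" if "i < k" for i
    using that by (simp add: k idx_def)
  have fodd: "f (- \<Omega>) = - f \<Omega>" for \<Omega>
    using odd_basis_indices_range(1)[OF idx]
    by (simp add: f_def Y_def poly_harm_uminus flip: sum_negf)
  have hemi: "?H \<in> sets borel"
  proof -
    have "?H = sphere 0 1 \<inter> {\<Omega>. n \<bullet> \<Omega> < 0}" by auto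
    then show ?thesis by (simp add: sets.Int borel_closed borel_open open_halfspace_lt)
  qed
  have H: "H_odd g N \<rho> n $$ (i, j) = (LINT \<Omega>:?H|surface_measure. Y i \<Omega> * (Y j \<Omega> - \<rho> * Y j (reflect n \<Omega>)))"
    if "i < k" "j < k" for i j
  proof -
    have b: "vec_index (odd_basis g N \<Omega>) i = Y i \<Omega>" if "i < k" "norm \<Omega> = 1" for i \<Omega>
      using that unfolding Y_def k_def by (intro odd_basis_nth) (auto simp: idx_def)
    have r: "norm (reflect n \<Omega>) = norm \<Omega>" for \<Omega>
      using orthogonal_reflect[OF n] by (rule orthogonal_transformation_norm)
    show ?thesis
      using that unfolding H_odd_def set_lebesgue_integral_def k_def[symmetric]
      by (auto simp: b r indicator_def intro!: Bochner_Integration.integral_cong)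
  qed
  \<comment> \<open>Expanding \<open>f\<close> splits the integrand of its reflection form into the terms \<open>F i j\<close>.\<close>
  define F where "F i j \<Omega> = indicator ?H \<Omega> *\<^sub>R ((c i * Y i \<Omega>) * (c j * (Y j \<Omega> - \<rho> * Y j (reflect n \<Omega>))))" for i j \<Omega>
  have F_int: "integrable surface_measure (F i j)" for i j
    unfolding F_def set_integrable_def[symmetric]
    by (intro set_integrable_surface_measure continuous_intros Yc rc hemi)
  have F_sum: "(\<Sum>i<k. \<Sum>j<k. F i j \<Omega>) = indicator ?H \<Omega> *\<^sub>R (f \<Omega> * (f \<Omega> - \<rho> * f (reflect n \<Omega>)))" for \<Omega>
  proof -
    have "f \<Omega> - \<rho> * f (reflect n \<Omega>) = (\<Sum>j<k. c j * (Y j \<Omega> - \<rho> * Y j (reflect n \<Omega>)))"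
      by (simp add: f_def sum_distrib_left sum_subtractf right_diff_distrib mult.left_commute)
    then show ?thesis
      by (simp only: f_def[of \<Omega>] F_def sum_product scaleR_sum_right)
  qed
  \<comment> \<open>The quadratic form of the matrix at \<open>v\<close> is the reflection form of \<open>f\<close>.\<close>
  have "0 = (\<Sum>i<k. c i * vec_index (H_odd g N \<rho> n *\<^sub>v v) i)" by (simp add: Hv)
  also have "\<dots> = (\<Sum>i<k. \<Sum>j<k. c i * (H_odd g N \<rho> n $$ (i, j) * c j))"
    using v by (intro sum.cong refl)
      (simp add: H_odd_def k_def[symmetric] scalar_prod_def c_def sum_distrib_left lessThan_atLeast0)
  also have "\<dots> = (\<Sum>i<k. \<Sum>j<k. LINT \<Omega>|surface_measure. F i j \<Omega>)"
    by (simp add: H F_def set_lebesgue_integral_def mult_ac flip: integral_mult_right_zero)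
  also have "\<dots> = (\<Sum>i<k. LINT \<Omega>|surface_measure. (\<Sum>j<k. F i j \<Omega>))"
    by (intro sum.cong refl Bochner_Integration.integral_sum[symmetric] F_int)
  also have "\<dots> = (LINT \<Omega>|surface_measure. (\<Sum>i<k. \<Sum>j<k. F i j \<Omega>))"
    by (intro Bochner_Integration.integral_sum[symmetric] Bochner_Integration.integrable_sum F_int)
  also have "\<dots> = (LINT \<Omega>:?H|surface_measure. f \<Omega> * (f \<Omega> - \<rho> * f (reflect n \<Omega>)))"
    by (simp only: F_sum set_lebesgue_integral_def)
  finally have Q: "(LINT \<Omega>:?H|surface_measure. f \<Omega> * (f \<Omega> - \<rho> * f (reflect n \<Omega>))) = 0" by simp
  have f0: "f \<Omega> = 0" if "norm \<Omega> = 1" for \<Omega>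
    by (rule hemisphere_form_definite[OF fc fodd n _ Q that]) (use assms(4,5) in auto)
  \<comment> \<open>The coefficients, indexed by the pair \<open>(l, m)\<close> instead of its position.\<close>
  define C where "C p = c (the_inv_into {..<k} (\<lambda>i. idx ! i) p)" for p
  have bij: "bij_betw (\<lambda>i. idx ! i) {..<k} (set idx)"
    by (rule bij_betw_nth) (simp_all add: idx_def k distinct_odd_basis_indices)
  then have C: "C (idx ! i) = c i" if "i < k" for i
    using that by (simp add: C_def the_inv_into_f_f bij_betw_def)
  have "c i = 0" if i: "i < k" for i
  proof -
    have "C (fst (idx ! i), snd (idx ! i)) = 0"
    proof (rule poly_harm_independent)
      fix \<mu> \<phi> :: real assume "\<mu> \<in> {-1..1}"
      then have "0 = f (sphere_point (\<mu>, \<phi>))" by (simp add: f0 norm_sphere_point)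
      also have "\<dots> = (\<Sum>i<k. case idx ! i of (l, m) \<Rightarrow> C (l, m) * poly_harm l m (sphere_point (\<mu>, \<phi>)))"
        unfolding f_def by (intro sum.cong refl) (auto simp: C[symmetric] Y_def case_prod_beta)
      also have "\<dots> = (\<Sum>(l, m)\<in>set idx. C (l, m) * poly_harm l m (sphere_point (\<mu>, \<phi>)))"
        by (rule sum.reindex_bij_betw[OF bij])
      finally show "(\<Sum>(l, m)\<in>set idx. C (l, m) * poly_harm l m (sphere_point (\<mu>, \<phi>))) = 0" by simp
    next
      show "(fst (idx ! i), snd (idx ! i)) \<in> set idx" using i by (simp add: k)
    next
      fix l m assume "(l, m) \<in> set idx"
      then show "nat \<bar>m\<bar> \<le> l" by (auto simp: idx_def dest: odd_basis_indices_range(2))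
    qed simp
    then show ?thesis using C[OF i] by simp
  qed
  then show "v = 0\<^sub>v k" using v by (intro eq_vecI) (auto simp: c_def)
qed

end
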